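(* Let $n\ge1$ and let $D_0(n)$ denote either of the checkered diagrams $Ch^1_n$ or $Ch^2_n$. Then $\mathcal{P}(D_0(n))$ is ranked if and only if $n\le 3$. Moreover, $\mathcal{P}(D_0(n))$ is both ranked and bounded if and only if $n\le 2$.
   Context: A diagram is a finite set $D$ of cells $(r,c)$ with $r,c$ positive integers; $r$ is the row (rows numbered from bottom to top starting at 1) and $c$ the column (numbered from left to right starting at 1). A Kohnert move at row $r$ applied to a diagram $D$: if row $r$ of $D$ is empty, $D$ is unchanged; otherwise let $(r,c)$ be the cell of row $r$ with the largest column index; if every position $(r',c)$ with $1\le r'<r$ belongs to $D$, then $D$ is unchanged; otherwise let $r'$ be the largest integer with $1\le r'<r$ and $(r',c)\notin D$, and the move replaces the cell $(r,c)$ by $(r',c)$. For a diagram $D_0$, $KD(D_0)$ is the set of all diagrams obtainable from $D_0$ by finite (possibly empty) sequences of Kohnert moves; the Kohnert poset $\mathcal{P}(D_0)$ is $KD(D_0)$ ordered by $D_2\preceq D_1$ iff $D_2$ can be obtained from $D_1$ by a finite sequence of Kohnert moves. A finite poset is bounded if it has a unique minimal and a unique maximal element; it is ranked if there is $\rho:P\to\mathbb{Z}_{\ge0}$ with $x\prec y\Rightarrow\rho(x)<\rho(y)$ and $\rho(y)=\rho(x)+1$ whenever $y$ covers $x$. Checkered diagrams: $Ch^1_n=\{(2i-1,2j-1):1\le i,j\le\lceil n/2\rceil\}\cup\{(2i,2j):1\le i,j\le\lfloor n/2\rfloor\}$ and $Ch^2_n=\{(2i-1,2j):1\le i\le\lceil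 n/2\rceil,\ 1\le j\le\lfloor n/2\rfloor\}\cup\{(2i,2j-1):1\le i\le\lfloor n/2\rfloor,\ 1\le j\le\lceil n/2\rceil\}$. *)

theory Defs
  imports Main
begin

text \<open>
  A cell is a pair (row, column); rows are numbered from bottom to top and columns from left to
  right, both starting at 1.
\<close>

type_synonym diagram = "(nat \<times> nat) set"

definition is_diagram :: "diagram \<Rightarrow> bool" where
  "is_diagram D \<longleftrightarrow> finite D \<and> (\<forall>(r, c) \<in> D. 1 \<le> r \<and> 1 \<le> c)"

definition kohnert_move :: "nat \<Rightarrow> diagram \<Rightarrow> diagram" where
  "kohnert_move r D =
     (if {c. (r, c) \<in> D} = {} then D
      else let c = Max {c. (r, c) \<in> D} in
        if \<forall>r'. 1 \<le> r' \<and> r' < r \<longrightarrow> (r', c) \<in> D then D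
        else let r' = Max {r'. 1 \<le> r' \<and> r' < r \<and> (r', c) \<notin> D} in
          insert (r', c) (D - {(r, c)}))"

definition kohnert_step :: "diagram rel" where
  "kohnert_step = {(D, kohnert_move r D) | D r. 1 \<le> r}"

definition KD :: "diagram \<Rightarrow> diagram set" where
  "KD D0 = {D. (D0, D) \<in> kohnert_step\<^sup>*}"

text \<open>
  The Kohnert poset of \<open>D0\<close> is the set \<open>KD D0\<close> together with the relation \<open>kohnert_order D0\<close>,
  which contains \<open>(D2, D1)\<close> iff \<open>D2 \<preceq> D1\<close>; see \<open>finite_KD\<close> and \<open>partial_order_on_kohnert_order\<close>
  below.
\<close>

definition kohnert_order :: "diagram \<Rightarrow> diagram rel" where
  "kohnert_order D0 = {(D2, D1). D1 \<in> KD D0 \<and> D2 \<in> KD D0 \<and> (D1, D2) \<in> kohnert_step\<^sup>*}"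

text \<open>
  Below, \<open>le\<close> is a partial order on \<open>P\<close>, with \<open>(x, y) \<in> le\<close> meaning that \<open>x\<close> is below or equal
  to \<open>y\<close>.
\<close>

definition minimal_in :: "'a set \<Rightarrow> 'a rel \<Rightarrow> 'a \<Rightarrow> bool" where
  "minimal_in P le x \<longleftrightarrow> x \<in> P \<and> (\<forall>y\<in>P. (y, x) \<in> le \<longrightarrow> y = x)"

definition maximal_in :: "'a set \<Rightarrow> 'a rel \<Rightarrow> 'a \<Rightarrow> bool" where
  "maximal_in P le x \<longleftrightarrow> x \<in> P \<and> (\<forall>y\<in>P. (x, y) \<in> le \<longrightarrow> y = x)"

definition bounded_poset :: "'a set \<Rightarrow> 'a rel \<Rightarrow> bool" where
  "bounded_poset P le \<longleftrightarrow> (\<exists>!x. minimal_in P le x) \<and> (\<exists>!x. maximal_in P le x)"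

definition less_in :: "'a rel \<Rightarrow> 'a \<Rightarrow> 'a \<Rightarrow> bool" where
  "less_in le x y \<longleftrightarrow> (x, y) \<in> le \<and> x \<noteq> y"

definition covers_in :: "'a set \<Rightarrow> 'a rel \<Rightarrow> 'a \<Rightarrow> 'a \<Rightarrow> bool" where
  "covers_in P le y x \<longleftrightarrow>
     less_in le x y \<and> \<not> (\<exists>z\<in>P. less_in le x z \<and> less_in le z y)"

definition ranked_poset :: "'a set \<Rightarrow> 'a rel \<Rightarrow> bool" where
  "ranked_poset P le \<longleftrightarrow>
     (\<exists>\<rho> :: 'a \<Rightarrow> nat.
        (\<forall>x\<in>P. \<forall>y\<in>P. less_in le x y \<longrightarrow> \<rho> x < \<rho> y) \<and>
        (\<forall>x\<in>P. \<forall>y\<in>P. covers_in P le y x \<longrightarrow> \<rho> y = \<rho> x + 1))"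

text \<open>
  On natural numbers, \<open>(n + 1) div 2\<close> and \<open>n div 2\<close> are the ceiling and the floor of half of \<open>n\<close>;
  the truncated subtractions are exact because the indices are at least 1.
\<close>

definition Ch1 :: "nat \<Rightarrow> diagram" where
  "Ch1 n =
     {(2 * i - 1, 2 * j - 1) | i j. i \<in> {1..(n + 1) div 2} \<and> j \<in> {1..(n + 1) div 2}} \<union>
     {(2 * i, 2 * j) | i j. i \<in> {1..n div 2} \<and> j \<in> {1..n div 2}}"

definition Ch2 :: "nat \<Rightarrow> diagram" where
  "Ch2 n =
     {(2 * i - 1, 2 * j) | i j. i \<in> {1..(n + 1) div 2} \<and> j \<in> {1..n div 2}} \<union>
     {(2 * i, 2 * j - 1) | i j. i \<in> {1..n div 2} \<and> j \<in> {1..(n + 1) div 2}}"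

lemma Ch1_subset: "Ch1 n \<subseteq> {1..n} \<times> {1..n}"
  unfolding Ch1_def by auto

lemma Ch2_subset: "Ch2 n \<subseteq> {1..n} \<times> {1..n}"
  unfolding Ch2_def by auto

lemma is_diagram_subset: "D \<subseteq> {1..m} \<times> {1..n} \<Longrightarrow> is_diagram D"
  unfolding is_diagram_def using finite_subset[of D "{1..m} \<times> {1..n}"] by auto

lemma is_diagram_Ch1: "is_diagram (Ch1 n)"
  and is_diagram_Ch2: "is_diagram (Ch2 n)"
  by (rule is_diagram_subset[OF Ch1_subset], rule is_diagram_subset[OF Ch2_subset])

lemma is_diagram_bounded:
  assumes "is_diagram D"
  obtains m n where "D \<subseteq> {1..m} \<times> {1..n}"
proof
  have "finite D" and pos: "\<And>r c. (r, c) \<in> D \<Longrightarrow> 1 \<le> r \<and> 1 \<le> c"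
    using assms by (auto simp: is_diagram_def)
  show "D \<subseteq> {1..Max (fst ` D)} \<times> {1..Max (snd ` D)}"
  proof
    fix x assume x: "x \<in> D"
    have "fst x \<le> Max (fst ` D)" "snd x \<le> Max (snd ` D)"
      using \<open>finite D\<close> x by auto
    then show "x \<in> {1..Max (fst ` D)} \<times> {1..Max (snd ` D)}"
      using pos[of "fst x" "snd x"] x by (cases x) auto
  qed
qed

lemma kohnert_move_cases:
  assumes "finite D"
  obtains "kohnert_move r D = D"
  | c r' where "(r, c) \<in> D" "1 \<le> r'" "r' < r" "(r', c) \<notin> D"
      "kohnert_move r D = insert (r', c) (D - {(r, c)})"
proof (cases "kohnert_move r D = D")
  case True
  then show ?thesis using that by blast
next
  case False
  define C where "C = {c. (r, c) \<in> D}"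
  define c where "c = Max C"
  define R where "R = {r'. 1 \<le> r' \<and> r' < r \<and> (r', c) \<notin> D}"
  have ne: "C \<noteq> {}" "R \<noteq> {}"
    using False by (auto simp: kohnert_move_def C_def c_def R_def Let_def split: if_splits)
  have "finite C"
    using finite_imageI[OF assms, of snd] unfolding C_def
    by (rule finite_subset[rotated]) force
  then have "c \<in> C" using ne by (simp add: c_def)
  have "finite R" unfolding R_def by simp
  then have "Max R \<in> R" using ne by simp
  have "kohnert_move r D = insert (Max R, c) (D - {(r, c)})"
    using ne unfolding kohnert_move_def C_def[symmetric] c_def[symmetric] Let_def R_def[symmetric]
    by (auto simp: R_def)
  with \<open>c \<in> C\<close> \<open>Max R \<in> R\<close> show ?thesis
    using that(2)[of c "Max R"] by (simp add: C_def R_def)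
qed

lemma kohnert_steps_subset:
  assumes "(D, D') \<in> kohnert_step\<^sup>*" "D \<subseteq> {1..m} \<times> {1..n}"
  shows "D' \<subseteq> {1..m} \<times> {1..n}"
  using assms
proof (induction rule: rtrancl_induct)
  case (step E F)
  then obtain r where F: "F = kohnert_move r E"
    by (auto simp: kohnert_step_def)
  have E: "E \<subseteq> {1..m} \<times> {1..n}" using step by blast
  then have "finite E" by (rule finite_subset) simp
  then show ?case
  proof (rule kohnert_move_cases[of E r])
    fix c r'
    assume *: "(r, c) \<in> E" "1 \<le> r'" "r' < r"
      "kohnert_move r E = insert (r', c) (E - {(r, c)})"
    have "(r, c) \<in> {1..m} \<times> {1..n}" using E *(1) by (rule subsetD)
    then have "(r', c) \<in> {1..m} \<times> {1..n}" using *(2,3) by simp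
    moreover have "E - {(r, c)} \<subseteq> {1..m} \<times> {1..n}"
      using E by (rule subset_trans[OF Diff_subset])
    ultimately show ?thesis unfolding F *(4) by (simp only: insert_subset)
  qed (use E F in simp)
qed

lemma finite_KD:
  assumes "is_diagram D0"
  shows "finite (KD D0)"
proof -
  obtain m n where "D0 \<subseteq> {1..m} \<times> {1..n}"
    using is_diagram_bounded[OF assms] .
  then have "KD D0 \<subseteq> Pow ({1..m} \<times> {1..n})"
    using kohnert_steps_subset unfolding KD_def by blast
  then show ?thesis by (rule finite_subset) simp
qed

lemma is_diagram_KD:
  assumes "is_diagram D0" "D \<in> KD D0"
  shows "is_diagram D"
proof -
  obtain m n where "D0 \<subseteq> {1..m} \<times> {1..n}"
    using is_diagram_bounded[OF assms(1)] .
  then have "D \<subseteq> {1..m} \<times> {1..n}"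
    using kohnert_steps_subset assms(2) by (simp add: KD_def)
  then show ?thesis by (rule is_diagram_subset)
qed

lemma kohnert_steps_row_sum:
  assumes "(D, D') \<in> kohnert_step\<^sup>*" "is_diagram D"
  shows "D' = D \<or> sum fst D' < sum fst D"
  using assms
proof (induction rule: rtrancl_induct)
  case (step E F)
  then obtain r where F: "F = kohnert_move r E"
    by (auto simp: kohnert_step_def)
  have "finite E"
    using is_diagram_KD[of D E] step by (auto simp: KD_def is_diagram_def)
  then have "F = E \<or> sum fst F < sum fst E"
  proof (rule kohnert_move_cases[of E r])
    fix c r'
    assume *: "(r, c) \<in> E" "1 \<le> r'" "r' < r" "(r', c) \<notin> E"
      "kohnert_move r E = insert (r', c) (E - {(r, c)})"
    then have "sum fst F = r' + sum fst (E - {(r, c)})"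
      using \<open>finite E\<close> F by simp
    moreover have "sum fst E = r + sum fst (E - {(r, c)})"
      using \<open>finite E\<close> * by (simp add: sum.remove)
    ultimately show ?thesis using * by simp
  qed (use F in auto)
  then show ?case using step by auto
qed simp

lemma partial_order_on_kohnert_order:
  assumes "is_diagram D0"
  shows "partial_order_on (KD D0) (kohnert_order D0)"
  unfolding partial_order_on_def preorder_on_def
proof (intro conjI)
  show "refl_on (KD D0) (kohnert_order D0)"
    by (auto simp: refl_on_def kohnert_order_def)
  show "kohnert_order D0 \<subseteq> KD D0 \<times> KD D0"
    by (auto simp: kohnert_order_def)
  show "trans (kohnert_order D0)"
    by (auto simp: trans_def kohnert_order_def)
  show "antisym (kohnert_order D0)"
  proof (rule antisymI)
    fix x y
    assume xy: "(x, y) \<in> kohnert_order D0" "(y, x) \<in> kohnert_order D0"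
    then have "is_diagram x" "is_diagram y"
      using is_diagram_KD[OF assms] by (auto simp: kohnert_order_def)
    with xy show "x = y"
      using kohnert_steps_row_sum[of x y] kohnert_steps_row_sum[of y x]
      by (auto simp: kohnert_order_def)
  qed
qed

end

theory Submission
  imports Defs
begin

text \<open>
  For \<open>n \<le> 3\<close> no move ever jumps over a cell: a jump needs a column with cells in rows 2 and 3 but
  none in row 1, while every column of \<open>D0\<close> with two cells has one of them in row 1, where it
  stays forever. Hence each effective move lowers the sum of the row indices by one, and that sum
  is a rank function. For \<open>n = 3\<close> there are two minimal diagrams.

  A move that jumps over cells is still a cover, provided that none of the cells jumped over is
  rightmost in its row. For \<open>n \<ge> 4\<close> this yields, inside the four lowest rows of the last two or
  three columns, two saturated chains of different lengths with the same end points: the top cell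
  of the column \<open>{2, 3}\<close> reaches \<open>{1, 2}\<close> either by one jump or, once row 2 is free on its
  right, by two single drops.
\<close>

section \<open>Effective moves\<close>

text \<open>Relational form of an effective move, free of \<open>Max\<close>: the last conjunct
  makes \<open>r'\<close> the highest gap below \<open>(r, c)\<close>, so \<open>D\<close> and
  \<open>r\<close> determine both \<open>c\<close> and \<open>r'\<close>.\<close>

definition drops :: "diagram \<Rightarrow> nat \<Rightarrow> nat \<Rightarrow> nat \<Rightarrow> bool" where
  "drops D r c r' \<longleftrightarrow> (r, c) \<in> D \<and> (\<forall>d. (r, d) \<in> D \<longrightarrow> d \<le> c) \<and> 1 \<le> r' \<and> r' < r \<and>
     (r', c) \<notin> D \<and> (\<forall>s. r' < s \<and> s < r \<longrightarrow> (s, c) \<in> D)"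

abbreviation move_cell :: "diagram \<Rightarrow> nat \<Rightarrow> nat \<Rightarrow> nat \<Rightarrow> diagram" where
  "move_cell D r c r' \<equiv> insert (r', c) (D - {(r, c)})"

lemma finite_row: "finite (D :: diagram) \<Longrightarrow> finite {c. (r, c) \<in> D}"
  by (rule finite_subset[of _ "snd ` D"]) force+

lemma kohnert_move_drops:
  assumes "finite D" "drops D r c r'"
  shows "kohnert_move r D = move_cell D r c r'"
proof -
  have "Max {c. (r, c) \<in> D} = c"
    using assms finite_row by (intro Max_eqI) (auto simp: drops_def)
  moreover have "Max {s. 1 \<le> s \<and> s < r \<and> (s, c) \<notin> D} = r'"
    using assms(2) by (intro Max_eqI) (auto simp: drops_def intro: leI)
  ultimately show ?thesis
    using assms(2) unfolding kohnert_move_def Let_def by (auto simp: drops_def)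
qed

lemma kohnert_move_neq:
  assumes "finite D" "kohnert_move r D \<noteq> D"
  obtains c r' where "drops D r c r'" "kohnert_move r D = move_cell D r c r'"
proof -
  define c where "c = Max {c. (r, c) \<in> D}"
  define R where "R = {s. 1 \<le> s \<and> s < r \<and> (s, c) \<notin> D}"
  have ne: "{c. (r, c) \<in> D} \<noteq> {}" "R \<noteq> {}"
    using assms(2) by (auto simp: kohnert_move_def c_def R_def Let_def split: if_splits)
  have fin: "finite R" by (simp add: R_def)
  have "(r, c) \<in> D" "\<And>d. (r, d) \<in> D \<Longrightarrow> d \<le> c"
    using Max_in[OF finite_row[OF assms(1)] ne(1)] finite_row[OF assms(1)]
    by (auto simp: c_def)
  moreover have "1 \<le> Max R" "Max R < r" "(Max R, c) \<notin> D"
    using Max_in[OF fin ne(2)] unfolding R_def by simp_all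
  moreover have "(s, c) \<in> D" if "Max R < s" "s < r" for s
  proof (rule ccontr)
    assume "(s, c) \<notin> D"
    then have "s \<in> R" using that by (simp add: R_def)
    then show False using Max_ge[OF fin, of s] that by simp
  qed
  ultimately have "drops D r c (Max R)" unfolding drops_def by blast
  then show ?thesis using that kohnert_move_drops[OF assms(1)] by blast
qed

lemma kohnert_step_neq:
  assumes "(D, E) \<in> kohnert_step" "finite D" "E \<noteq> D"
  obtains r c r' where "drops D r c r'" "E = move_cell D r c r'"
  using assms kohnert_move_neq unfolding kohnert_step_def by (smt (verit) mem_Collect_eq prod.inject)

lemma kohnert_step_drops:
  assumes "finite D" "drops D r c r'"
  shows "(D, move_cell D r c r') \<in> kohnert_step"
  using kohnert_move_drops[OF assms] assms(2) unfolding kohnert_step_def drops_def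
  by (smt (verit) le_trans less_imp_le_nat mem_Collect_eq)

lemma sum_move_cell:
  assumes "finite D" "drops D r c r'"
  shows "sum fst D + r' = sum fst (move_cell D r c r') + r"
  using assms by (auto simp: drops_def sum.remove[of D "(r, c)"])

text \<open>A chain of steps may idle at \<open>D\<close>, because ineffective moves count as steps;
  the induction from the front skips them.\<close>

lemma first_drop:
  assumes "(D, E) \<in> kohnert_step\<^sup>*" "finite D" "E \<noteq> D"
  obtains r c r' where "drops D r c r'" "(move_cell D r c r', E) \<in> kohnert_step\<^sup>*"
proof -
  have "\<exists>r c r'. drops D r c r' \<and> (move_cell D r c r', E) \<in> kohnert_step\<^sup>*"
    using assms
  proof (induction rule: converse_rtrancl_induct)
    case (step D F)
    show ?case
    proof (cases "F = D")
      case True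
      then show ?thesis using step.IH step.prems by simp
    next
      case False
      obtain r c r' where "drops D r c r'" "F = move_cell D r c r'"
        using kohnert_step_neq[OF step.hyps(1) step.prems(1) False] .
      then show ?thesis using step.hyps(2) by blast
    qed
  qed simp
  then show ?thesis using that by blast
qed

lemma finite_steps:
  assumes "(D, E) \<in> kohnert_step\<^sup>*" "finite D"
  shows "finite E"
  using assms
proof (induction rule: rtrancl_induct)
  case (step E F)
  then show ?case by (cases "F = E") (auto elim!: kohnert_step_neq)
qed simp

section \<open>Covers\<close>

text \<open>A monovariant for the order: counting from below, a drop from row \<open>r\<close> to
  \<open>r'\<close> raises the counts of its own column for \<open>r' \<le> k < r\<close> and
  changes no other count.\<close>

definition column_count :: "diagram \<Rightarrow> nat \<Rightarrow> nat \<Rightarrow> nat" where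
  "column_count D c k = card {r. r \<le> k \<and> (r, c) \<in> D}"

lemma column_count_move_cell:
  assumes "drops D r c r'"
  shows "column_count (move_cell D r c r') d k =
    column_count D d k + (if d = c \<and> r' \<le> k \<and> k < r then 1 else 0)"
proof -
  have *: "(r, c) \<in> D" "r' < r" "(r', c) \<notin> D" using assms by (auto simp: drops_def)
  consider "d \<noteq> c" | "d = c" "k < r'" | "d = c" "r' \<le> k" "k < r" | "d = c" "r \<le> k" by linarith
  then show ?thesis
  proof cases
    case 1
    then show ?thesis by (simp add: column_count_def)
  next
    case 2
    then have "{s. s \<le> k \<and> (s, d) \<in> move_cell D r c r'} = {s. s \<le> k \<and> (s, d) \<in> D}"
      using * by auto
    then show ?thesis using 2 by (simp add: column_count_def)
  next
    case 3
    then have "{s. s \<le> k \<and> (s, d) \<in> move_cell D r c r'} = insert r' {s. s \<le> k \<and> (s, d) \<in> D}"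
      using * by auto
    then show ?thesis using 3 * by (simp add: column_count_def)
  next
    \<comment> \<open>Both rows lie below the threshold, so the two sets arise from the same
      \<open>A\<close> by adding one element each.\<close>
    case 4
    define A where "A = {s. s \<le> k \<and> (s, d) \<in> D} - {r}"
    have "finite A" "r \<notin> A" "r' \<notin> A" using 4 * by (auto simp: A_def)
    then have "card (insert r' A) = card (insert r A)" by simp
    moreover have "{s. s \<le> k \<and> (s, d) \<in> move_cell D r c r'} = insert r' A"
      "{s. s \<le> k \<and> (s, d) \<in> D} = insert r A"
      using 4 * by (auto simp: A_def)
    ultimately show ?thesis using 4 by (simp add: column_count_def)
  qed
qed

lemma column_count_mono:
  assumes "(D, E) \<in> kohnert_step\<^sup>*" "finite D"
  shows "column_count D c k \<le> column_count E c k"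
  using assms
proof (induction rule: rtrancl_induct)
  case (step E F)
  then have "column_count E c k \<le> column_count F c k"
    using finite_steps[OF step(1)]
    by (cases "F = E") (auto elim!: kohnert_step_neq simp: column_count_move_cell)
  then show ?case using step by simp
qed simp

lemma KD_move_cell:
  assumes "finite D" "D \<in> KD D0" "drops D r c r'"
  shows "move_cell D r c r' \<in> KD D0"
  using kohnert_step_drops[OF assms(1,3)] assms(2) by (auto simp: KD_def)

text \<open>
  Column counts only grow along moves. A first move towards a diagram strictly between \<open>D\<close> and
  \<open>move_cell D r c r'\<close> must therefore act in column \<open>c\<close> on a row in \<open>{r'<..r}\<close>, and
  \<open>blocked\<close> leaves only row \<open>r\<close>.
\<close>

lemma covers_move_cell:
  assumes D0: "is_diagram D0" and KD: "D \<in> KD D0" and dr: "drops D r c r'"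
    and blocked: "\<And>s. r' < s \<Longrightarrow> s < r \<Longrightarrow> \<exists>d>c. (s, d) \<in> D"
  shows "covers_in (KD D0) (kohnert_order D0) D (move_cell D r c r')"
proof -
  let ?E = "move_cell D r c r'"
  have fin: "finite D" using is_diagram_KD[OF D0 KD] by (simp add: is_diagram_def)
  have rr: "r' < r" "(r, c) \<in> D" "(r', c) \<notin> D" using dr by (auto simp: drops_def)
  have "less_in (kohnert_order D0) ?E D"
    using KD KD_move_cell[OF fin KD dr] kohnert_step_drops[OF fin dr] rr
    by (auto simp: less_in_def kohnert_order_def)
  moreover have False
    if "Z \<in> KD D0" "less_in (kohnert_order D0) ?E Z" "less_in (kohnert_order D0) Z D" for Z
  proof -
    have steps: "(D, Z) \<in> kohnert_step\<^sup>*" "(Z, ?E) \<in> kohnert_step\<^sup>*" "Z \<noteq> D" "Z \<noteq> ?E"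
      using that by (auto simp: less_in_def kohnert_order_def)
    obtain s d s' where ds: "drops D s d s'" and to_Z: "(move_cell D s d s', Z) \<in> kohnert_step\<^sup>*"
      using first_drop[OF steps(1) fin steps(3)] .
    have "(move_cell D s d s', ?E) \<in> kohnert_step\<^sup>*" using to_Z steps(2) by simp
    \<comment> \<open>Both diagrams are one drop away from \<open>D\<close>, so monotonicity
      compares two indicator functions. Evaluated at \<open>k = s'\<close> and
      \<open>k = s - 1\<close> it gives \<open>d = c\<close>, \<open>r' \<le> s'\<close> and
      \<open>s \<le> r\<close>.\<close>
    from column_count_mono[OF this] have le:
      "(if e = d \<and> s' \<le> k \<and> k < s then 1 else 0) \<le> (if e = c \<and> r' \<le> k \<and> k < r then 1 else 0 :: nat)"
      for e k
      using fin column_count_move_cell[OF ds, of e k] column_count_move_cell[OF dr, of e k]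
      by (metis (no_types, lifting) finite_Diff finite_insert nat_add_left_cancel_le)
    have ss: "s' < s" "(s, d) \<in> D" "\<And>e. (s, e) \<in> D \<Longrightarrow> e \<le> d" using ds by (auto simp: drops_def)
    have [simp]: "d = c" using le[of d s'] ss by (auto split: if_splits)
    have "r' \<le> s'" using le[of d s'] ss by (auto split: if_splits)
    moreover have "s \<le> r" using le[of d "s - 1"] ss by (auto split: if_splits)
    \<comment> \<open>Were \<open>s < r\<close>, row \<open>s\<close> would be one of the rows
      jumped over and have a cell to the right of \<open>c\<close>, so its cell in column
      \<open>c\<close> could not move.\<close>
    ultimately have "s = r"
      using blocked[of s] ss by (metis \<open>d = c\<close> leD le_eq_less_or_eq le_less_trans)
    moreover have "s' = r'"
    proof (rule ccontr)
      assume "s' \<noteq> r'"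
      then have "(s', c) \<in> D" using dr ss \<open>r' \<le> s'\<close> \<open>s = r\<close> by (auto simp: drops_def)
      then show False using ds by (simp add: drops_def)
    qed
    \<comment> \<open>The first move is thus the move to \<open>?E\<close> itself, which puts
      \<open>Z\<close> below \<open>?E\<close> as well as above it.\<close>
    ultimately have "(?E, Z) \<in> kohnert_step\<^sup>*" using to_Z by simp
    then have "(Z, ?E) \<in> kohnert_order D0" "(?E, Z) \<in> kohnert_order D0"
      using that by (auto simp: less_in_def kohnert_order_def)
    then show False
      using partial_order_on_kohnert_order[OF D0] steps(4)
      unfolding partial_order_on_def by (blast dest: antisymD)
  qed
  ultimately show ?thesis by (auto simp: covers_in_def)
qed

text \<open>A sufficient condition for a cover that does not mention the poset, so it can be checked
  in a small window and transferred to the whole diagram.\<close>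

definition cover_drop :: "diagram \<Rightarrow> diagram \<Rightarrow> bool" where
  "cover_drop D E \<longleftrightarrow> (\<exists>r c r'. drops D r c r' \<and> (\<forall>s. r' < s \<and> s < r \<longrightarrow> (\<exists>d>c. (s, d) \<in> D)) \<and>
     E = move_cell D r c r')"

lemma drops_1:
  assumes "(r' + 1, c) \<in> D" "\<And>d. (r' + 1, d) \<in> D \<Longrightarrow> d \<le> c" "1 \<le> r'" "(r', c) \<notin> D"
  shows "drops D (r' + 1) c r'"
  using assms by (auto simp: drops_def)

lemma cover_drop_1:
  assumes "(r' + 1, c) \<in> D" "\<And>d. (r' + 1, d) \<in> D \<Longrightarrow> d \<le> c" "1 \<le> r'" "(r', c) \<notin> D"
    "E = move_cell D (r' + 1) c r'"
  shows "cover_drop D E"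
  using drops_1[OF assms(1-4)] assms(5) unfolding cover_drop_def by fastforce

text \<open>The shortest jump, over the single cell \<open>(r' + 1, c)\<close>; the cell
  \<open>(r' + 1, d)\<close> to its right keeps that cell from dropping first.\<close>

lemma cover_drop_2:
  assumes "(r' + 2, c) \<in> D" "\<And>d. (r' + 2, d) \<in> D \<Longrightarrow> d \<le> c" "1 \<le> r'" "(r', c) \<notin> D"
    "(r' + 1, c) \<in> D" "(r' + 1, d) \<in> D" "c < d" "E = move_cell D (r' + 2) c r'"
  shows "cover_drop D E"
proof -
  have between: "s = r' + 1" if "r' < s" "s < r' + 2" for s using that by simp
  have "drops D (r' + 2) c r'"
    unfolding drops_def
  proof (intro conjI allI impI)
    fix s assume "r' < s \<and> s < r' + 2"
    then have "s = r' + 1" by simp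
    then show "(s, c) \<in> D" using assms(5) by simp
  qed (use assms in simp_all)
  moreover have "\<forall>s. r' < s \<and> s < r' + 2 \<longrightarrow> (\<exists>d>c. (s, d) \<in> D)"
    using assms(6,7) between by metis
  ultimately show ?thesis using assms(8) unfolding cover_drop_def by blast
qed

section \<open>Large checkered diagrams\<close>

text \<open>Membership of \<open>E\<close> comes along with the rank equation, so that a chain of
  drops can be followed step by step.\<close>

lemma ranked_KD_covers:
  assumes D0: "is_diagram D0" and ranked: "ranked_poset (KD D0) (kohnert_order D0)"
  obtains \<rho> :: "diagram \<Rightarrow> nat" where
    "\<And>D E. D \<in> KD D0 \<Longrightarrow> cover_drop D E \<Longrightarrow> E \<in> KD D0 \<and> \<rho> D = \<rho> E + 1"
proof -
  obtain \<rho> :: "diagram \<Rightarrow> nat" where \<rho>: "\<And>x y. x \<in> KD D0 \<Longrightarrow> y \<in> KD D0 \<Longrightarrow>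
      covers_in (KD D0) (kohnert_order D0) y x \<Longrightarrow> \<rho> y = \<rho> x + 1"
    using ranked unfolding ranked_poset_def by blast
  show ?thesis
  proof (rule that[of \<rho>])
    fix D E assume KD: "D \<in> KD D0" and "cover_drop D E"
    then obtain r c r' where dr: "drops D r c r'" "\<And>s. r' < s \<Longrightarrow> s < r \<Longrightarrow> \<exists>d>c. (s, d) \<in> D"
      and E: "E = move_cell D r c r'"
      unfolding cover_drop_def by blast
    have "finite D" using is_diagram_KD[OF D0 KD] by (simp add: is_diagram_def)
    then have "E \<in> KD D0" using KD_move_cell[OF _ KD dr(1)] E by simp
    then show "E \<in> KD D0 \<and> \<rho> D = \<rho> E + 1"
      using covers_move_cell[OF D0 KD dr] \<rho>[OF _ KD] E by simp
  qed
qed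

text \<open>
  Cells above row \<open>m\<close> or left of column \<open>a\<close> do not interfere with moves inside the window
  \<open>W\<close>, so a rank function of the whole poset restricts to the diagrams reachable in the window.
\<close>

lemma ranked_KD_window:
  assumes D0: "is_diagram D0" and ranked: "ranked_poset (KD D0) (kohnert_order D0)"
    and low: "\<And>r c. r \<le> m \<Longrightarrow> a \<le> c \<Longrightarrow> (r, c) \<in> D0 \<longleftrightarrow> (r, c) \<in> W"
    and W: "W \<subseteq> {..m} \<times> {a..}"
  obtains S and \<rho> :: "diagram \<Rightarrow> nat" where "W \<in> S"
    "\<And>A B. A \<in> S \<Longrightarrow> cover_drop A B \<Longrightarrow> B \<in> S \<and> \<rho> A = \<rho> B + 1"
proof -
  from ranked_KD_covers[OF D0 ranked] obtain \<rho> :: "diagram \<Rightarrow> nat" where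
    \<rho>: "\<And>D E. D \<in> KD D0 \<Longrightarrow> cover_drop D E \<Longrightarrow> E \<in> KD D0 \<and> \<rho> D = \<rho> E + 1"
    by blast
  define L where "L = {(r, c). (r, c) \<in> D0 \<and> (m < r \<or> c < a)}"
  have D0_split: "D0 = L \<union> W"
  proof (rule set_eqI)
    fix x :: "nat \<times> nat"
    obtain r c where "x = (r, c)" by (cases x)
    then show "x \<in> D0 \<longleftrightarrow> x \<in> L \<union> W"
      using low[of r c] W by (cases "r \<le> m \<and> a \<le> c") (auto simp: L_def)
  qed
  define S where "S = {A. L \<union> A \<in> KD D0 \<and> A \<subseteq> {..m} \<times> {a..}}"
  show ?thesis
  proof (rule that[of S "\<lambda>A. \<rho> (L \<union> A)"])
    show "W \<in> S" using D0_split W by (simp add: S_def KD_def)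
  next
    fix A B assume "A \<in> S" and "cover_drop A B"
    then obtain r c r' where dr: "drops A r c r'"
      and blocked: "\<And>s. r' < s \<Longrightarrow> s < r \<Longrightarrow> \<exists>d>c. (s, d) \<in> A" and B: "B = move_cell A r c r'"
      unfolding cover_drop_def by blast
    have A: "L \<union> A \<in> KD D0" "A \<subseteq> {..m} \<times> {a..}" using \<open>A \<in> S\<close> by (auto simp: S_def)
    then have rc: "r \<le> m" "a \<le> c" "r' < r" using dr by (auto simp: drops_def)
    \<comment> \<open>Cells of \<open>L\<close> in rows up to \<open>m\<close> lie left of column
      \<open>a\<close>: they neither change which cell of row \<open>r\<close> is rightmost nor fill
      a gap in column \<open>c\<close>.\<close>
    have "drops (L \<union> A) r c r'"
      using dr rc by (auto simp: drops_def L_def)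
    moreover have "L \<union> B = move_cell (L \<union> A) r c r'"
      using dr rc B by (auto simp: drops_def L_def)
    ultimately have "cover_drop (L \<union> A) (L \<union> B)"
      using blocked unfolding cover_drop_def by blast
    moreover have "B \<subseteq> {..m} \<times> {a..}" using A B rc by auto
    ultimately show "B \<in> S \<and> \<rho> (L \<union> A) = \<rho> (L \<union> B) + 1"
      using \<rho> A by (simp add: S_def)
  qed
qed

text \<open>The chains part after cover 1. Covers 2 and 3 lower \<open>(3, b)\<close> first, which
  blocks \<open>(2, a)\<close> and makes \<open>(3, a)\<close> jump; covers 4 to 6 lower
  \<open>(2, a)\<close> first. They reach the same diagram in two and in three steps.\<close>

lemma not_ranked_two_columns:
  assumes D0: "is_diagram D0" and ab: "a < b"
    and low: "\<And>r c. r \<le> 4 \<Longrightarrow> a \<le> c \<Longrightarrow>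
      (r, c) \<in> D0 \<longleftrightarrow> (r, c) \<in> {(2, a), (4, a), (1, b), (3, b)}"
  shows "\<not> ranked_poset (KD D0) (kohnert_order D0)"
proof
  assume ranked: "ranked_poset (KD D0) (kohnert_order D0)"
  have W: "{(2, a), (4, a), (1, b), (3, b)} \<subseteq> {..4 :: nat} \<times> {a..}" using ab by auto
  obtain S and \<rho> :: "diagram \<Rightarrow> nat" where S0: "{(2, a), (4, a), (1, b), (3, b)} \<in> S"
    and \<rho>: "\<And>A B. A \<in> S \<Longrightarrow> cover_drop A B \<Longrightarrow> B \<in> S \<and> \<rho> A = \<rho> B + 1"
    using ranked_KD_window[OF D0 ranked low W] by blast
  have 1: "cover_drop {(2, a), (4, a), (1, b), (3, b)} {(2, a), (3, a), (1, b), (3, b)}"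
    using ab by (intro cover_drop_1[of 3 a]) auto
  have 2: "cover_drop {(2, a), (3, a), (1, b), (3, b)} {(2, a), (3, a), (1, b), (2, b)}"
    using ab by (intro cover_drop_1[of 2 b]) auto
  have 3: "cover_drop {(2, a), (3, a), (1, b), (2, b)} {(1, a), (2, a), (1, b), (2, b)}"
    using ab by (intro cover_drop_2[of 1 a _ b]) auto
  have 4: "cover_drop {(2, a), (3, a), (1, b), (3, b)} {(1, a), (3, a), (1, b), (3, b)}"
    using ab by (intro cover_drop_1[of 1 a]) auto
  have 5: "cover_drop {(1, a), (3, a), (1, b), (3, b)} {(1, a), (3, a), (1, b), (2, b)}"
    using ab by (intro cover_drop_1[of 2 b]) auto
  have 6: "cover_drop {(1, a), (3, a), (1, b), (2, b)} {(1, a), (2, a), (1, b), (2, b)}"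
    using ab by (intro cover_drop_1[of 2 a]) auto
  note s1 = \<rho>[OF S0 1]
  note s2 = \<rho>[OF s1[THEN conjunct1] 2]
  note s3 = \<rho>[OF s2[THEN conjunct1] 3]
  note s4 = \<rho>[OF s1[THEN conjunct1] 4]
  note s5 = \<rho>[OF s4[THEN conjunct1] 5]
  note s6 = \<rho>[OF s5[THEN conjunct1] 6]
  show False
    using s2 s3 s4 s5 s6 by simp
qed

text \<open>The two-column pattern with one more column on its right. Covers 1 to 3 bring column
  \<open>c\<close> to rows 1 and 3, like column \<open>b\<close>, which frees row 2 to the right of
  \<open>a\<close>. From there covers 4 to 6 and 7 to 10 end in the same diagram.\<close>

lemma not_ranked_three_columns:
  assumes D0: "is_diagram D0" and abc: "a < b" "b < c"
    and low: "\<And>r d. r \<le> 4 \<Longrightarrow> a \<le> d \<Longrightarrow>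
      (r, d) \<in> D0 \<longleftrightarrow> (r, d) \<in> {(2, a), (4, a), (1, b), (3, b), (2, c), (4, c)}"
  shows "\<not> ranked_poset (KD D0) (kohnert_order D0)"
proof
  assume ranked: "ranked_poset (KD D0) (kohnert_order D0)"
  have W: "{(2, a), (4, a), (1, b), (3, b), (2, c), (4, c)} \<subseteq> {..4 :: nat} \<times> {a..}" using abc by auto
  obtain S and \<rho> :: "diagram \<Rightarrow> nat"
    where S0: "{(2, a), (4, a), (1, b), (3, b), (2, c), (4, c)} \<in> S"
    and \<rho>: "\<And>A B. A \<in> S \<Longrightarrow> cover_drop A B \<Longrightarrow> B \<in> S \<and> \<rho> A = \<rho> B + 1"
    using ranked_KD_window[OF D0 ranked low W] by blast
  have 1: "cover_drop {(2, a), (4, a), (1, b), (3, b), (2, c), (4, c)}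
      {(2, a), (4, a), (1, b), (3, b), (2, c), (3, c)}"
    using abc by (intro cover_drop_1[of 3 c]) auto
  have 2: "cover_drop {(2, a), (4, a), (1, b), (3, b), (2, c), (3, c)}
      {(2, a), (3, a), (1, b), (3, b), (2, c), (3, c)}"
    using abc by (intro cover_drop_1[of 3 a]) auto
  have 3: "cover_drop {(2, a), (3, a), (1, b), (3, b), (2, c), (3, c)}
      {(2, a), (3, a), (1, b), (3, b), (1, c), (3, c)}"
    using abc by (intro cover_drop_1[of 1 c]) auto
  have 4: "cover_drop {(2, a), (3, a), (1, b), (3, b), (1, c), (3, c)}
      {(2, a), (3, a), (1, b), (3, b), (1, c), (2, c)}"
    using abc by (intro cover_drop_1[of 2 c]) auto
  have 5: "cover_drop {(2, a), (3, a), (1, b), (3, b), (1, c), (2, c)}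
      {(2, a), (3, a), (1, b), (2, b), (1, c), (2, c)}"
    using abc by (intro cover_drop_1[of 2 b]) auto
  have 6: "cover_drop {(2, a), (3, a), (1, b), (2, b), (1, c), (2, c)}
      {(1, a), (2, a), (1, b), (2, b), (1, c), (2, c)}"
    using abc by (intro cover_drop_2[of 1 a _ b]) auto
  have 7: "cover_drop {(2, a), (3, a), (1, b), (3, b), (1, c), (3, c)}
      {(1, a), (3, a), (1, b), (3, b), (1, c), (3, c)}"
    using abc by (intro cover_drop_1[of 1 a]) auto
  have 8: "cover_drop {(1, a), (3, a), (1, b), (3, b), (1, c), (3, c)}
      {(1, a), (3, a), (1, b), (3, b), (1, c), (2, c)}"
    using abc by (intro cover_drop_1[of 2 c]) auto
  have 9: "cover_drop {(1, a), (3, a), (1, b), (3, b), (1, c), (2, c)}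
      {(1, a), (3, a), (1, b), (2, b), (1, c), (2, c)}"
    using abc by (intro cover_drop_1[of 2 b]) auto
  have 10: "cover_drop {(1, a), (3, a), (1, b), (2, b), (1, c), (2, c)}
      {(1, a), (2, a), (1, b), (2, b), (1, c), (2, c)}"
    using abc by (intro cover_drop_1[of 2 a]) auto
  note s1 = \<rho>[OF S0 1]
  note s2 = \<rho>[OF s1[THEN conjunct1] 2]
  note s3 = \<rho>[OF s2[THEN conjunct1] 3]
  note s4 = \<rho>[OF s3[THEN conjunct1] 4]
  note s5 = \<rho>[OF s4[THEN conjunct1] 5]
  note s6 = \<rho>[OF s5[THEN conjunct1] 6]
  note s7 = \<rho>[OF s3[THEN conjunct1] 7]
  note s8 = \<rho>[OF s7[THEN conjunct1] 8]
  note s9 = \<rho>[OF s8[THEN conjunct1] 9]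
  note s10 = \<rho>[OF s9[THEN conjunct1] 10]
  show False
    using s4 s5 s6 s7 s8 s9 s10 by simp
qed

section \<open>Checkered diagrams as parity patterns\<close>

lemma mem_Ch1: "(r, c) \<in> Ch1 n \<longleftrightarrow> r \<in> {1..n} \<and> c \<in> {1..n} \<and> even (r + c)"
proof
  assume "(r, c) \<in> Ch1 n"
  then show "r \<in> {1..n} \<and> c \<in> {1..n} \<and> even (r + c)"
    unfolding Ch1_def by auto
next
  assume *: "r \<in> {1..n} \<and> c \<in> {1..n} \<and> even (r + c)"
  show "(r, c) \<in> Ch1 n"
  proof (cases "even r")
    case True
    with * obtain i j where "r = 2 * i" "c = 2 * j" by (auto elim!: evenE)
    with * show ?thesis unfolding Ch1_def by auto
  next
    case False
    with * obtain i j where "r = 2 * i + 1" "c = 2 * j + 1" by (auto elim!: oddE)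
    with * have "r = 2 * (i + 1) - 1 \<and> c = 2 * (j + 1) - 1 \<and>
        i + 1 \<in> {1..(n + 1) div 2} \<and> j + 1 \<in> {1..(n + 1) div 2}"
      by auto
    then show ?thesis unfolding Ch1_def by blast
  qed
qed

lemma mem_Ch2: "(r, c) \<in> Ch2 n \<longleftrightarrow> r \<in> {1..n} \<and> c \<in> {1..n} \<and> odd (r + c)"
proof
  assume "(r, c) \<in> Ch2 n"
  then show "r \<in> {1..n} \<and> c \<in> {1..n} \<and> odd (r + c)"
    unfolding Ch2_def by auto
next
  assume *: "r \<in> {1..n} \<and> c \<in> {1..n} \<and> odd (r + c)"
  show "(r, c) \<in> Ch2 n"
  proof (cases "even r")
    case True
    with * obtain i j where "r = 2 * i" "c = 2 * j + 1" by (auto elim!: evenE oddE)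
    with * have "r = 2 * i \<and> c = 2 * (j + 1) - 1 \<and>
        i \<in> {1..n div 2} \<and> j + 1 \<in> {1..(n + 1) div 2}"
      by auto
    then show ?thesis unfolding Ch2_def by blast
  next
    case False
    with * obtain i j where "r = 2 * i + 1" "c = 2 * j" by (auto elim!: evenE oddE)
    with * have "r = 2 * (i + 1) - 1 \<and> c = 2 * j \<and>
        i + 1 \<in> {1..(n + 1) div 2} \<and> j \<in> {1..n div 2}"
      by auto
    then show ?thesis unfolding Ch2_def by blast
  qed
qed

lemma not_ranked_checkered:
  assumes n: "4 \<le> n" and D0: "D0 = Ch1 n \<or> D0 = Ch2 n"
  shows "\<not> ranked_poset (KD D0) (kohnert_order D0)"
proof -
  have dia: "is_diagram D0" using D0 is_diagram_Ch1 is_diagram_Ch2 by auto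
  have small: "r \<in> {0, 1, 2, 3, 4}" if "r \<le> 4" for r :: nat using that by auto
  show ?thesis
  \<comment> \<open>What matters is the pattern of the last column, not \<open>Ch1\<close> versus
    \<open>Ch2\<close>: it fixes all columns counted from the right. If it starts in row 1, the last
    two columns form the window, otherwise the last three.\<close>
  proof (cases "(1, n) \<in> D0")
    case True
    have mem_D0: "(r, c) \<in> D0 \<longleftrightarrow> r \<in> {1..n} \<and> c \<in> {1..n} \<and> (odd r \<longleftrightarrow> even (n + c))" for r c
      using D0 True by (auto simp: mem_Ch1 mem_Ch2)
    show ?thesis
    proof (rule not_ranked_two_columns[OF dia])
      show "n - 1 < n" using n by simp
      fix r c :: nat assume "r \<le> 4" "n - 1 \<le> c"
      then have "c = n - 1 \<or> c = n \<or> n < c" by auto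
      with small[OF \<open>r \<le> 4\<close>] n
      show "(r, c) \<in> D0 \<longleftrightarrow> (r, c) \<in> {(2, n - 1), (4, n - 1), (1, n), (3, n)}"
        unfolding mem_D0 by (elim insertE disjE emptyE) auto
    qed
  next
    case False
    have mem_D0: "(r, c) \<in> D0 \<longleftrightarrow> r \<in> {1..n} \<and> c \<in> {1..n} \<and> (even r \<longleftrightarrow> even (n + c))" for r c
      using D0 False n by (auto simp: mem_Ch1 mem_Ch2)
    show ?thesis
    proof (rule not_ranked_three_columns[OF dia])
      show "n - 2 < n - 1" "n - 1 < n" using n by auto
      fix r c :: nat assume "r \<le> 4" "n - 2 \<le> c"
      then have "c = n - 2 \<or> c = n - 1 \<or> c = n \<or> n < c" by auto
      with small[OF \<open>r \<le> 4\<close>] n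
      show "(r, c) \<in> D0 \<longleftrightarrow>
          (r, c) \<in> {(2, n - 2), (4, n - 2), (1, n - 1), (3, n - 1), (2, n), (4, n)}"
        unfolding mem_D0 by (elim insertE disjE emptyE) auto
    qed
  qed
qed

section \<open>Small checkered diagrams\<close>

text \<open>The first effective move on the way from \<open>y\<close> down to \<open>x\<close>
  already leads strictly below \<open>y\<close>, so a cover is just one such move; it lowers the row
  sum by \<open>r - r' = 1\<close>.\<close>

lemma ranked_KD_if_single_drops:
  assumes D0: "is_diagram D0"
    and single: "\<And>D r c r'. D \<in> KD D0 \<Longrightarrow> drops D r c r' \<Longrightarrow> r = r' + 1"
  shows "ranked_poset (KD D0) (kohnert_order D0)"
  unfolding ranked_poset_def
proof (intro exI[of _ "sum fst"] conjI ballI impI)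
  fix x y assume "x \<in> KD D0" "y \<in> KD D0"
  then have dia: "is_diagram x" "is_diagram y" using is_diagram_KD[OF D0] by auto
  show less: "sum fst x < sum fst y" if "less_in (kohnert_order D0) x y"
    using that dia kohnert_steps_row_sum[of y x] by (auto simp: less_in_def kohnert_order_def)
  assume cov: "covers_in (KD D0) (kohnert_order D0) y x"
  then have yx: "(y, x) \<in> kohnert_step\<^sup>*" "x \<noteq> y"
    by (auto simp: covers_in_def less_in_def kohnert_order_def)
  have fin: "finite y" using dia by (simp add: is_diagram_def)
  from first_drop[OF yx(1) fin yx(2)] obtain r c r'
    where dr: "drops y r c r'" and to_x: "(move_cell y r c r', x) \<in> kohnert_step\<^sup>*" .
  let ?z = "move_cell y r c r'"
  have "?z \<in> KD D0" using KD_move_cell[OF fin \<open>y \<in> KD D0\<close> dr] .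
  moreover have "?z \<noteq> y" using dr by (auto simp: drops_def)
  moreover have "(y, ?z) \<in> kohnert_step\<^sup>*" using kohnert_step_drops[OF fin dr] by simp
  ultimately have "x = ?z"
    using cov to_x \<open>x \<in> KD D0\<close> \<open>y \<in> KD D0\<close>
    by (auto simp: covers_in_def less_in_def kohnert_order_def)
  then show "sum fst y = sum fst x + 1"
    using sum_move_cell[OF fin dr] single[OF \<open>y \<in> KD D0\<close> dr] by simp
qed

lemma KD_induct [consumes 2, case_names start drops]:
  assumes "D \<in> KD D0" "finite D0" "Q D0"
    and "\<And>D r c r'. D \<in> KD D0 \<Longrightarrow> Q D \<Longrightarrow> drops D r c r' \<Longrightarrow> Q (move_cell D r c r')"
  shows "Q D"
proof -
  have "(D0, D) \<in> kohnert_step\<^sup>*" using assms(1) by (simp add: KD_def)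
  then show ?thesis
  proof (induction rule: rtrancl_induct)
    case (step E F)
    then show ?case
      using finite_steps[OF step(1) assms(2)] assms(4)[of E]
      by (cases "F = E") (auto elim!: kohnert_step_neq simp: KD_def)
  qed (rule assms(3))
qed

lemma ranked_checkered:
  assumes n: "n \<le> 3" and D0: "D0 = Ch1 n \<or> D0 = Ch2 n"
  shows "ranked_poset (KD D0) (kohnert_order D0)"
proof (rule ranked_KD_if_single_drops)
  show dia: "is_diagram D0" using D0 is_diagram_Ch1 is_diagram_Ch2 by auto
  \<comment> \<open>The implication is vacuous at the start, as parity forbids vertically adjacent
    cells. Each drop empties row 2 or row 3 of its column, where the implication is then vacuous
    again.\<close>
  define Q :: "diagram \<Rightarrow> bool" where
    "Q D \<longleftrightarrow> (\<forall>(r, c)\<in>D. r \<le> 3) \<and> (\<forall>c. (2, c) \<in> D \<longrightarrow> (3, c) \<in> D \<longrightarrow> (1, c) \<in> D)" for D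
  fix D r c r' assume "D \<in> KD D0" and dr: "drops D r c r'"
  have "finite D0" using dia by (simp add: is_diagram_def)
  with \<open>D \<in> KD D0\<close> have "Q D"
  proof (induction rule: KD_induct)
    case start
    show ?case using D0 n by (auto simp: Q_def mem_Ch1 mem_Ch2)
  next
    case (drops D r c r')
    then show ?case by (auto simp: Q_def drops_def)
  qed
  show "r = r' + 1"
  proof (rule ccontr)
    assume "r \<noteq> r' + 1"
    \<comment> \<open>With three rows a jump can only pass over \<open>(2, c)\<close>; then
      \<open>Q\<close> puts a cell at \<open>(1, c)\<close>, the supposed gap.\<close>
    then have "r = 3 \<and> r' = 1" using dr \<open>Q D\<close> by (fastforce simp: drops_def Q_def)
    with dr \<open>Q D\<close> show False by (auto simp: drops_def Q_def)
  qed
qed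

section \<open>Extremal elements and boundedness\<close>

lemma minimal_iff_no_drops:
  assumes D0: "is_diagram D0" and D: "D \<in> KD D0"
  shows "minimal_in (KD D0) (kohnert_order D0) D \<longleftrightarrow> (\<forall>r c r'. \<not> drops D r c r')"
proof -
  have fin: "finite D" using is_diagram_KD[OF D0 D] by (simp add: is_diagram_def)
  show ?thesis
  proof (intro iffI allI notI)
    fix r c r' assume min: "minimal_in (KD D0) (kohnert_order D0) D" and dr: "drops D r c r'"
    have "(move_cell D r c r', D) \<in> kohnert_order D0"
      using D KD_move_cell[OF fin D dr] kohnert_step_drops[OF fin dr]
      by (simp add: kohnert_order_def)
    then have "move_cell D r c r' = D"
      using min KD_move_cell[OF fin D dr] by (simp add: minimal_in_def)
    then show False using dr by (auto simp: drops_def)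
  next
    assume *: "\<forall>r c r'. \<not> drops D r c r'"
    have "E = D" if "(E, D) \<in> kohnert_order D0" for E
    proof (rule ccontr)
      assume "E \<noteq> D"
      moreover have "(D, E) \<in> kohnert_step\<^sup>*" using that by (simp add: kohnert_order_def)
      ultimately show False using first_drop[OF _ fin] * by metis
    qed
    then show "minimal_in (KD D0) (kohnert_order D0) D"
      using D by (simp add: minimal_in_def)
  qed
qed

lemma ex1_maximal_KD:
  assumes D0: "is_diagram D0"
  shows "\<exists>!x. maximal_in (KD D0) (kohnert_order D0) x"
proof -
  have D0_in: "D0 \<in> KD D0" by (simp add: KD_def)
  have top: "(x, D0) \<in> kohnert_order D0" if "x \<in> KD D0" for x
    using that D0_in by (simp add: kohnert_order_def KD_def)
  have "antisym (kohnert_order D0)"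
    using partial_order_on_kohnert_order[OF D0] by (simp add: partial_order_on_def)
  then have "maximal_in (KD D0) (kohnert_order D0) D0"
    using top D0_in unfolding maximal_in_def by (meson antisymD)
  then show ?thesis using top D0_in unfolding maximal_in_def by blast
qed

text \<open>A diagram of least row sum is minimal, since every drop lowers that sum.\<close>

lemma ex_minimal_KD:
  assumes D0: "is_diagram D0"
  shows "\<exists>x. minimal_in (KD D0) (kohnert_order D0) x"
proof -
  have "D0 \<in> KD D0" by (simp add: KD_def)
  then obtain D where D: "D \<in> KD D0" and least: "\<And>E. E \<in> KD D0 \<Longrightarrow> sum fst D \<le> sum fst E"
    using ex_has_least_nat[of "\<lambda>D. D \<in> KD D0" D0 "sum fst"] by blast
  have fin: "finite D" using is_diagram_KD[OF D0 D] by (simp add: is_diagram_def)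
  have "\<not> drops D r c r'" for r c r'
  proof
    assume dr: "drops D r c r'"
    then have "r' < r" by (simp add: drops_def)
    then show False
      using sum_move_cell[OF fin dr] least[OF KD_move_cell[OF fin D dr]] by linarith
  qed
  then show ?thesis using minimal_iff_no_drops[OF D0 D] by blast
qed

text \<open>For \<open>n \<le> 2\<close> a column has at most one cell, so no cell of row 2 rests on
  another one; everything sinks to row 1, and moves preserve the set of occupied columns.\<close>

lemma bounded_checkered:
  assumes n: "n \<le> 2" and D0: "D0 = Ch1 n \<or> D0 = Ch2 n"
  shows "bounded_poset (KD D0) (kohnert_order D0)"
proof -
  have dia: "is_diagram D0" using D0 is_diagram_Ch1 is_diagram_Ch2 by auto
  then have fin0: "finite D0" by (simp add: is_diagram_def)
  have inv: "(\<forall>(r, c)\<in>D. r = 1 \<or> r = 2) \<and> (\<forall>c. (2, c) \<in> D \<longrightarrow> (1, c) \<notin> D) \<and> snd ` D = snd ` D0"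
    if "D \<in> KD D0" for D
    using that fin0
  proof (induction rule: KD_induct)
    case start
    show ?case using D0 n by (auto simp: mem_Ch1 mem_Ch2)
  next
    case (drops D r c r')
    then have "r = 2" "r' = 1" "(2, c) \<in> D" by (auto simp: drops_def)
    moreover from this have "snd ` move_cell D r c r' = snd ` D" by force
    ultimately show ?case using drops.IH by auto
  qed
  have bottom: "D = {1} \<times> snd ` D0" if "minimal_in (KD D0) (kohnert_order D0) D" for D
  proof -
    have D: "D \<in> KD D0" using that by (simp add: minimal_in_def)
    have fin: "finite {c. (2, c) \<in> D}"
      using finite_row is_diagram_KD[OF dia D] by (simp add: is_diagram_def)
    have "(2, c) \<notin> D" for c
    proof
      assume "(2, c) \<in> D"
      then have "Max {c. (2, c) \<in> D} \<in> {c. (2, c) \<in> D}" using fin by (intro Max_in) auto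
      \<comment> \<open>The rightmost cell of row 2 is the one a move acts on, and
        \<open>inv\<close> leaves the place below it free.\<close>
      then have "drops D 2 (Max {c. (2, c) \<in> D}) 1"
        using inv[OF D] fin by (auto simp: drops_def)
      then show False using that minimal_iff_no_drops[OF dia D] by blast
    qed
    then have "\<forall>(r, c)\<in>D. r = 1" using inv[OF D] by fastforce
    then have "D = {1} \<times> snd ` D" by force
    then show ?thesis using inv[OF D] by simp
  qed
  then show ?thesis
    using ex_minimal_KD[OF dia] ex1_maximal_KD[OF dia] unfolding bounded_poset_def by metis
qed

lemma not_bounded_KD:
  assumes D0: "is_diagram D0" and "D \<in> KD D0" "E \<in> KD D0" "x \<in> D" "x \<notin> E"
    and "\<And>r c r'. \<not> drops D r c r'" "\<And>r c r'. \<not> drops E r c r'"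
  shows "\<not> bounded_poset (KD D0) (kohnert_order D0)"
proof -
  have "minimal_in (KD D0) (kohnert_order D0) D" "minimal_in (KD D0) (kohnert_order D0) E"
    using assms minimal_iff_no_drops[OF D0] by simp_all
  moreover have "D \<noteq> E" using assms by auto
  ultimately show ?thesis unfolding bounded_poset_def by blast
qed

text \<open>Only the rightmost cell of a row can move, and from row 2 only into an empty place of
  row 1.\<close>

lemma no_drops_two_rows:
  assumes "\<And>r c. (r, c) \<in> D \<Longrightarrow> r = 1 \<or> r = 2 \<and> ((1, c) \<in> D \<or> (\<exists>d>c. (2, d) \<in> D))"
  shows "\<not> drops D r c r'"
proof
  assume dr: "drops D r c r'"
  then have "(r, c) \<in> D" by (simp add: drops_def)
  from assms[OF this] dr have "r = 2" "(1, c) \<in> D" by (auto simp: drops_def)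
  with dr have "r' = 1" by (auto simp: drops_def)
  with dr \<open>(1, c) \<in> D\<close> show False by (simp add: drops_def)
qed

text \<open>A cell of row 2 either drops in time or is shielded for good by a cell on its right that
  rests on row 1: \<open>(2, 2)\<close> by \<open>(2, 3)\<close> for \<open>Ch1 3\<close>, and
  \<open>(2, 1)\<close> by \<open>(2, 2)\<close> for \<open>Ch2 3\<close>. Each alternative leads to
  a minimal diagram of its own.\<close>

lemma not_bounded_checkered_3:
  assumes "D0 = Ch1 3 \<or> D0 = Ch2 3"
  shows "\<not> bounded_poset (KD D0) (kohnert_order D0)"
proof -
  have dia: "is_diagram D0" using assms is_diagram_Ch1 is_diagram_Ch2 by auto
  have start: "D0 \<in> KD D0" by (simp add: KD_def)
  have drop: "E \<in> KD D0" if "D \<in> KD D0" "(r' + 1, c) \<in> D" "\<And>d. (r' + 1, d) \<in> D \<Longrightarrow> d \<le> c"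
    "1 \<le> r'" "(r', c) \<notin> D" "E = move_cell D (r' + 1) c r'" for D E c r'
    using KD_move_cell[OF _ that(1) drops_1[OF that(2-5)]] is_diagram_KD[OF dia that(1)] that(6)
    by (simp add: is_diagram_def)
  have range_3: "{1..3} = {1, 2, 3 :: nat}" by auto
  from assms show ?thesis
  proof
    assume "D0 = Ch1 3"
    also have "Ch1 3 = {(1, 1), (1, 3), (2, 2), (3, 1), (3, 3)}"
      by (auto simp: mem_Ch1[of _ _ 3, unfolded range_3])
    finally have 0: "{(1, 1), (1, 3), (2, 2), (3, 1), (3, 3)} \<in> KD D0" using start by simp
    have 1: "{(1, 1), (1, 3), (2, 2), (3, 1), (2, 3)} \<in> KD D0"
      by (rule drop[OF 0, of 2 3]) auto
    have 2: "{(1, 1), (1, 3), (2, 2), (2, 1), (2, 3)} \<in> KD D0"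
      by (rule drop[OF 1, of 2 1]) auto
    have 3: "{(1, 1), (1, 3), (1, 2), (3, 1), (3, 3)} \<in> KD D0"
      by (rule drop[OF 0, of 1 2]) auto
    have 4: "{(1, 1), (1, 3), (1, 2), (3, 1), (2, 3)} \<in> KD D0"
      by (rule drop[OF 3, of 2 3]) auto
    have 5: "{(1, 1), (1, 3), (1, 2), (2, 1), (2, 3)} \<in> KD D0"
      by (rule drop[OF 4, of 2 1]) auto
    show ?thesis
      by (rule not_bounded_KD[OF dia 2 5, of "(2, 2)"]; (rule no_drops_two_rows)?) auto
  next
    assume "D0 = Ch2 3"
    also have "Ch2 3 = {(1, 2), (2, 1), (2, 3), (3, 2)}"
      by (auto simp: mem_Ch2[of _ _ 3, unfolded range_3])
    finally have 0: "{(1, 2), (2, 1), (2, 3), (3, 2)} \<in> KD D0" using start by simp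
    have 1: "{(1, 2), (2, 1), (1, 3), (3, 2)} \<in> KD D0"
      by (rule drop[OF 0, of 1 3]) auto
    have 2: "{(1, 2), (2, 1), (1, 3), (2, 2)} \<in> KD D0"
      by (rule drop[OF 1, of 2 2]) auto
    have 3: "{(1, 2), (1, 1), (1, 3), (3, 2)} \<in> KD D0"
      by (rule drop[OF 1, of 1 1]) auto
    have 4: "{(1, 2), (1, 1), (1, 3), (2, 2)} \<in> KD D0"
      by (rule drop[OF 3, of 2 2]) auto
    show ?thesis
      by (rule not_bounded_KD[OF dia 2 4, of "(2, 1)"]; (rule no_drops_two_rows)?) auto
  qed
qed

theorem theorem7p1:
  fixes n :: nat and D0 :: diagram
  assumes "n \<ge> 1"
    and "D0 = Ch1 n \<or> D0 = Ch2 n"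
  shows "(ranked_poset (KD D0) (kohnert_order D0) \<longleftrightarrow> n \<le> 3) \<and>
    (ranked_poset (KD D0) (kohnert_order D0) \<and> bounded_poset (KD D0) (kohnert_order D0)
      \<longleftrightarrow> n \<le> 2)"
proof -
  have ranked: "ranked_poset (KD D0) (kohnert_order D0) \<longleftrightarrow> n \<le> 3"
    using not_ranked_checkered[OF _ assms(2)] ranked_checkered[OF _ assms(2)] by fastforce
  \<comment> \<open>For \<open>n > 3\<close> both sides of the second equivalence already fail by
    \<open>ranked\<close>, so boundedness is settled only up to 3.\<close>
  moreover have "bounded_poset (KD D0) (kohnert_order D0) \<longleftrightarrow> n \<le> 2" if "n \<le> 3"
  proof (cases "n = 3")
    case True
    then show ?thesis using not_bounded_checkered_3 assms(2) by simp
  next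
    case False
    then show ?thesis using bounded_checkered[OF _ assms(2)] that by simp
  qed
  ultimately show ?thesis by auto
qed

end
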